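(* Let $Q$ be a nonempty closed convex subset of $\mathcal{COP}^p$. Then $$\mathrm{face}(Q,\mathcal{COP}^p)=\{D\in\mathcal{COP}^p:\ e_k^\top D\tau(j)=0\ \ \forall k\in M_Q(j),\ \forall j\in J_Q\},$$ where $\{\tau(j),j\in J_Q\}$ is the set of all minimal zeros of $Q$ and $M_Q(j)=\{k\in P:e_k^\top D\tau(j)=0\ \forall D\in Q\}$, $j\in J_Q$.
   Context: Let $p>1$ be an integer, $P=\{1,\dots,p\}$, $e_1,\dots,e_p$ the standard basis of $\mathbb R^p$, $\mathcal S(p)$ the space of real symmetric $p\times p$ matrices, $\mathcal{COP}^p=\{D\in\mathcal S(p): t^\top Dt\ge 0\ \forall t\in\mathbb R^p_+\}$ the cone of copositive matrices, and $T=\{t\in\mathbb R^p_+: \sum_{k\in P}t_k=1\}$. For $t\in\mathbb R^p_+$, $P_+(t)=\{k\in P:t_k>0\}$. For $Q\subset\mathcal{COP}^p$, the set of zeros of $Q$ is $T_0(Q)=\{t\in T: t^\top Dt=0\ \forall D\in Q\}$. A zero $\tau\in T_0(Q)$ is a minimal zero of $Q$ if there is no $t\in T_0(Q)$, $t\neq\tau$, with $P_+(t)\subset P_+(\tau)$ (inclusion not necessarily strict); equivalently, for closed convex $Q$, $\tau$ is a vertex of $\mathrm{conv}\,T_0(Q)$, and there are finitely many of them. If $T_0(Q)=\emptyset$ then $J_Q=\emptyset$. A convex subcone $F\subset\mathcal{COP}^p$ is a face of $\mathcal{COP}^p$ if $A,B\in\mathcal{COP}^p$ and $A+B\in F$ imply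 $A,B\in F$. $\mathrm{face}(S,C)$ denotes the minimal (by inclusion) face of a cone $C$ containing a set $S$. *)

theory Defs
  imports "HOL-Analysis.Analysis"
begin

text \<open>
  The index type \<open>'n\<close> plays the role of \<open>P = {1, \<dots>, p}\<close>, with \<open>p = CARD('n)\<close>.
  Symmetry is part of membership in the cone, so topological and convexity notions may be taken
  in the ambient space of all square matrices, in which the symmetric matrices form a closed
  subspace.
\<close>

definition copositive_cone :: "(real ^ 'n ^ 'n) set"
  where "copositive_cone =
    {D. transpose D = D \<and> (\<forall>t. (\<forall>k. 0 \<le> t $ k) \<longrightarrow> 0 \<le> t \<bullet> (D *v t))}"

definition unit_simplex :: "(real ^ 'n) set"
  where "unit_simplex = {t. (\<forall>k. 0 \<le> t $ k) \<and> (\<Sum>k\<in>UNIV. t $ k) = 1}"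

definition pos_support :: "real ^ 'n \<Rightarrow> 'n set"
  where "pos_support t = {k. 0 < t $ k}"

definition zeros :: "(real ^ 'n ^ 'n) set \<Rightarrow> (real ^ 'n) set"
  where "zeros Q = {t \<in> unit_simplex. \<forall>D\<in>Q. t \<bullet> (D *v t) = 0}"

definition minimal_zeros :: "(real ^ 'n ^ 'n) set \<Rightarrow> (real ^ 'n) set"
  where "minimal_zeros Q =
    {\<tau> \<in> zeros Q. \<not> (\<exists>t \<in> zeros Q. t \<noteq> \<tau> \<and> pos_support t \<subseteq> pos_support \<tau>)}"

text \<open>
  The index set \<open>M\<^sub>Q(j)\<close>, indexed here by the minimal zero \<open>\<tau>(j)\<close> itself instead of by \<open>j\<close>.
\<close>

definition M_set :: "(real ^ 'n ^ 'n) set \<Rightarrow> real ^ 'n \<Rightarrow> 'n set"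
  where "M_set Q \<tau> = {k. \<forall>D\<in>Q. axis k 1 \<bullet> (D *v \<tau>) = 0}"

text \<open>
  Faces in the conic sense; \<^const>\<open>convex_cone\<close> entails nonemptiness.
\<close>

definition cone_face :: "'a::real_vector set \<Rightarrow> 'a set \<Rightarrow> bool"
  where "cone_face F C \<longleftrightarrow>
    F \<subseteq> C \<and> convex_cone F \<and> (\<forall>A\<in>C. \<forall>B\<in>C. A + B \<in> F \<longrightarrow> A \<in> F \<and> B \<in> F)"

text \<open>
  \<^const>\<open>Least\<close> is taken with respect to inclusion; for a convex cone \<open>C\<close> and \<open>S \<subseteq> C\<close> the
  least face exists, and it is the only inclusion-minimal one.
\<close>

definition min_face :: "'a::real_vector set \<Rightarrow> 'a set \<Rightarrow> 'a set"
  where "min_face S C = (LEAST F. cone_face F C \<and> S \<subseteq> F)"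

lemma min_face:
  assumes C: "convex_cone C" and S: "S \<subseteq> C"
  shows cone_face_min_face: "cone_face (min_face S C) C"
    and subset_min_face: "S \<subseteq> min_face S C"
    and min_face_least: "\<And>G. cone_face G C \<Longrightarrow> S \<subseteq> G \<Longrightarrow> min_face S C \<subseteq> G"
    and min_face_eq_hull: "min_face S C = (\<lambda>F. cone_face F C) hull S"
proof -
  let ?H = "(\<lambda>F. cone_face F C) hull S"
  have CC: "cone_face C C"
    using C by (simp add: cone_face_def)
  have "convex_cone ?H"
    unfolding hull_def by (rule convex_cone_Inter) (simp add: cone_face_def)
  moreover have "?H \<subseteq> C"
    using hull_minimal[of S C "\<lambda>F. cone_face F C"] S CC by blast
  ultimately have face: "cone_face ?H C"
    unfolding cone_face_def hull_def by simp
  show eq: "min_face S C = ?H"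
    unfolding min_face_def
    by (rule Least_equality) (simp_all add: face hull_subset hull_minimal)
  show "cone_face (min_face S C) C"
    by (simp add: eq face)
  show "S \<subseteq> min_face S C"
    by (simp add: eq hull_subset)
  show "\<And>G. cone_face G C \<Longrightarrow> S \<subseteq> G \<Longrightarrow> min_face S C \<subseteq> G"
    by (simp add: eq hull_minimal)
qed

lemma min_face_unique_minimal:
  assumes "convex_cone C" and "S \<subseteq> C" and F: "cone_face F C" "S \<subseteq> F"
    and minimal: "\<And>G. cone_face G C \<Longrightarrow> S \<subseteq> G \<Longrightarrow> G \<subseteq> F \<Longrightarrow> G = F"
  shows "F = min_face S C"
proof -
  note least = min_face_least[OF assms(1,2) F]
  show ?thesis
    using minimal[OF cone_face_min_face[OF assms(1,2)] subset_min_face[OF assms(1,2)] least]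
    by (rule sym)
qed

lemma convex_cone_copositive_cone: "convex_cone copositive_cone"
  unfolding convex_cone_iff
proof (intro conjI ballI allI impI)
  show "0 \<in> copositive_cone"
    by (simp add: copositive_cone_def transpose_def vec_eq_iff)
next
  fix A B :: "real ^ 'n ^ 'n"
  assume "A \<in> copositive_cone" "B \<in> copositive_cone"
  then show "A + B \<in> copositive_cone"
    by (simp add: copositive_cone_def transpose_def vec_eq_iff
        matrix_vector_mult_add_rdistrib inner_add_right)
next
  fix A :: "real ^ 'n ^ 'n" and c :: real
  assume "A \<in> copositive_cone" "0 \<le> c"
  then show "c *\<^sub>R A \<in> copositive_cone"
    by (simp add: copositive_cone_def transpose_def vec_eq_iff
        flip: scaleR_matrix_vector_assoc)
qed

end

theory Submission
  imports Defs
begin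

text \<open>
  The right-hand side \<open>G\<close> is a face containing \<open>Q\<close>. Conversely let \<open>D \<in> G\<close> and let \<open>A\<close> be a
  relative interior point of \<open>Q\<close>; then \<open>A\<close> alone has the same zeros and the same sets \<open>M\<close> as \<open>Q\<close>.
  Every zero is a convex combination of minimal ones, so \<open>(A v)\<^sub>i = 0\<close> implies \<open>(D v)\<^sub>i = 0\<close> for all
  zeros \<open>v\<close>. This makes \<open>A - \<epsilon> D\<close> copositive for small \<open>\<epsilon> > 0\<close>, by induction on the support of the
  test vectors: near a zero \<open>v\<close>, the coordinates with \<open>(A v)\<^sub>i > 0\<close> contribute nonnegatively, and
  from the rest a multiple of \<open>v\<close> can be subtracted, without changing the value of the form, until
  the support shrinks. Hence \<open>A = (A - \<epsilon> D) + \<epsilon> D\<close> puts \<open>D\<close> into every face containing \<open>A\<close>.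
\<close>

section \<open>Zeros of copositive forms on the nonnegative orthant\<close>

lemma symmetric_inner_commute:
  fixes A :: "real ^ 'n ^ 'n"
  assumes "transpose A = A"
  shows "x \<bullet> (A *v y) = y \<bullet> (A *v x)"
  by (metis assms dot_lmul_matrix inner_commute transpose_matrix_vector)

lemma quadratic_form_add:
  fixes A :: "real ^ 'n ^ 'n"
  assumes "transpose A = A"
  shows "(x + y) \<bullet> (A *v (x + y)) = x \<bullet> (A *v x) + 2 * (y \<bullet> (A *v x)) + y \<bullet> (A *v y)"
  using symmetric_inner_commute[OF assms, of x y]
  by (simp add: matrix_vector_right_distrib inner_add_left inner_add_right)

lemma quadratic_form_scaleR:
  fixes A :: "real ^ 'n ^ 'n"
  shows "(c *\<^sub>R x) \<bullet> (A *v (c *\<^sub>R x)) = c\<^sup>2 * (x \<bullet> (A *v x))"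
  by (simp add: matrix_vector_mult_scaleR power2_eq_square)

text \<open>First-order condition: on the orthant the form has its minimum 0 at \<open>v\<close>,
  and moving along \<open>axis i 1\<close> stays in the orthant, so the derivative
  \<open>2 * (A *v v) $ i\<close> cannot be negative.\<close>

lemma copositive_zero_nonneg:
  fixes A :: "real ^ 'n ^ 'n"
  assumes A: "A \<in> copositive_cone" and v: "\<And>k. 0 \<le> v $ k" and zero: "v \<bullet> (A *v v) = 0"
  shows "0 \<le> (A *v v) $ i"
proof (rule ccontr)
  assume "\<not> 0 \<le> (A *v v) $ i"
  define a where "a = - (A *v v) $ i"
  \<comment> \<open>\<open>b\<close> dominates the diagonal entry at \<open>i\<close>, and the added
    1 makes it positive. For \<open>e = a / b\<close> the quadratic term is at most
    \<open>e * a\<close>, half of the linear decrease \<open>2 * e * a\<close>.\<close>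
  define b where "b = \<bar>axis i 1 \<bullet> (A *v axis i 1)\<bar> + 1"
  have a: "a > 0" and b: "b > 0"
    using \<open>\<not> 0 \<le> (A *v v) $ i\<close> by (auto simp: a_def b_def)
  define e where "e = a / b"
  have e: "e > 0"
    using a b by (simp add: e_def)
  have sym: "transpose A = A"
    using A by (simp add: copositive_cone_def)
  have "0 \<le> (v + e *\<^sub>R axis i 1) $ k" for k
    using v[of k] e by (simp add: axis_def)
  then have "0 \<le> (v + e *\<^sub>R axis i 1) \<bullet> (A *v (v + e *\<^sub>R axis i 1))"
    using A unfolding copositive_cone_def by blast
  also have "\<dots> = - 2 * e * a + e\<^sup>2 * (axis i 1 \<bullet> (A *v axis i 1))"
    unfolding quadratic_form_add[OF sym] quadratic_form_scaleR zero
    by (simp add: a_def inner_axis')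
  also have "\<dots> \<le> - 2 * e * a + e\<^sup>2 * b"
    using mult_left_mono[of "axis i 1 \<bullet> (A *v axis i 1)" b "e\<^sup>2"] by (simp add: b_def)
  also have "\<dots> = - e * a"
    using b by (simp add: e_def power2_eq_square field_simps)
  also have "\<dots> < 0"
    using e a by simp
  finally show False by simp
qed

text \<open>Complementary slackness: the form is the sum of the products
  \<open>v $ k * (A *v v) $ k\<close>, which are nonnegative by
  \<open>copositive_zero_nonneg\<close> and hence all vanish.\<close>

lemma copositive_zero_eq_0:
  fixes A :: "real ^ 'n ^ 'n"
  assumes A: "A \<in> copositive_cone" and v: "\<And>k. 0 \<le> v $ k" and zero: "v \<bullet> (A *v v) = 0"
    and i: "v $ i > 0"
  shows "(A *v v) $ i = 0"
proof -
  have "\<forall>k\<in>UNIV. v $ k * (A *v v) $ k = 0"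
    using zero v copositive_zero_nonneg[OF A v zero]
    by (subst sum_nonneg_eq_0_iff[symmetric]) (auto simp: inner_vec_def)
  with i show ?thesis
    by (metis UNIV_I mult_eq_0_iff less_irrefl)
qed

lemma zerosD:
  assumes "v \<in> zeros Q"
  shows "0 \<le> v $ k" and "(\<Sum>k\<in>UNIV. v $ k) = 1" and "D \<in> Q \<Longrightarrow> v \<bullet> (D *v v) = 0"
  using assms by (auto simp: zeros_def unit_simplex_def)

lemma inner_eq_0_cart:
  fixes x y :: "real ^ 'n"
  assumes "\<And>i. x $ i \<noteq> 0 \<Longrightarrow> y $ i = 0"
  shows "x \<bullet> y = 0"
  unfolding inner_vec_def by (intro sum.neutral) (use assms in auto)

section \<open>Decomposition of zeros into minimal zeros\<close>

text \<open>Ratio test: \<open>s\<close> is the least quotient \<open>u $ k / v $ k\<close> over the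
  support of \<open>v\<close>. So \<open>u - s *\<^sub>R v\<close> stays in the orthant and vanishes
  at \<open>k\<close>; both inductions on supports below shrink them this way.\<close>

lemma subtract_multiple_nonneg:
  fixes u v :: "real ^ 'n"
  assumes u: "\<And>k. 0 \<le> u $ k" and v: "\<And>k. 0 \<le> v $ k" and "v \<noteq> 0"
  obtains k s where "v $ k > 0" "0 \<le> s" "u $ k = s * v $ k" "\<And>j. s * v $ j \<le> u $ j"
proof -
  have ne: "pos_support v \<noteq> {}"
    using v \<open>v \<noteq> 0\<close> by (force simp: pos_support_def vec_eq_iff order.order_iff_strict)
  then obtain k where k: "k \<in> pos_support v"
      and min: "\<And>j. j \<in> pos_support v \<Longrightarrow> u $ k / v $ k \<le> u $ j / v $ j"
    using ex_is_arg_min_if_finite[of "pos_support v" "\<lambda>k. u $ k / v $ k"]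
    by (auto simp: is_arg_min_linorder)
  show ?thesis
  proof (rule that[of k "u $ k / v $ k"])
    fix j
    show "u $ k / v $ k * v $ j \<le> u $ j"
    proof (cases "v $ j > 0")
      case True
      with min[of j] show ?thesis
        by (simp add: pos_support_def field_simps)
    next
      case False
      then have "v $ j = 0"
        using v[of j] by simp
      with u show ?thesis by simp
    qed
  qed (use k u v in \<open>auto simp: pos_support_def\<close>)
qed

text \<open>Subtract the largest multiple of \<open>t\<close> that keeps \<open>v\<close> in the
  orthant and normalise the rest to \<open>w\<close>. It is again a zero: for \<open>D\<close> in
  \<open>Q\<close> the vector \<open>D *v v\<close> vanishes on the support of \<open>v\<close>,
  which contains that of \<open>t\<close>, so the cross term is 0.\<close>

lemma zeros_split:
  fixes Q :: "(real ^ 'n ^ 'n) set"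
  assumes Q: "Q \<subseteq> copositive_cone" and v: "v \<in> zeros Q" and t: "t \<in> zeros Q"
    and "t \<noteq> v" and sub: "pos_support t \<subseteq> pos_support v"
  obtains s w where "0 < s" "s < 1" "w \<in> zeros Q" "pos_support w \<subset> pos_support v"
    "v = s *\<^sub>R t + (1 - s) *\<^sub>R w"
proof -
  note v0 = zerosD(1)[OF v] and t0 = zerosD(1)[OF t]
  have "t \<noteq> 0"
    using zerosD(2)[OF t] by auto
  then obtain k s where k: "t $ k > 0" and "0 \<le> s" and vk: "v $ k = s * t $ k"
      and le: "\<And>j. s * t $ j \<le> v $ j"
    using subtract_multiple_nonneg[of v t] v0 t0 by metis
  have "k \<in> pos_support v"
    using k sub by (auto simp: pos_support_def)
  with \<open>0 \<le> s\<close> vk have s0: "0 < s"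
    by (cases "s = 0") (auto simp: pos_support_def)
  \<comment> \<open>The nonnegative remainder has total mass \<open>1 - s\<close>. For
    \<open>s = 1\<close> it would vanish and force \<open>v = t\<close>.\<close>
  have sum: "(\<Sum>j\<in>UNIV. v $ j - s * t $ j) = 1 - s"
    by (simp add: sum_subtractf zerosD(2)[OF v] zerosD(2)[OF t] flip: sum_distrib_left)
  have "s \<noteq> 1"
  proof
    assume "s = 1"
    with sum have "\<forall>j\<in>UNIV. v $ j - s * t $ j = 0"
      using le by (subst sum_nonneg_eq_0_iff[symmetric]) auto
    with \<open>s = 1\<close> \<open>t \<noteq> v\<close> show False
      by (auto simp: vec_eq_iff)
  qed
  moreover have "s \<le> 1"
    using sum sum_nonneg[of UNIV "\<lambda>j. v $ j - s * t $ j"] le by simp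
  ultimately have s1: "s < 1" by simp
  define w where "w = (1 / (1 - s)) *\<^sub>R (v + (- s) *\<^sub>R t)"
  have w: "w $ j = (v $ j - s * t $ j) / (1 - s)" for j
    by (simp add: w_def)
  have "w \<bullet> (D *v w) = 0" if D: "D \<in> Q" for D
  proof -
    have cop: "D \<in> copositive_cone" and sym: "transpose D = D"
      using D Q by (auto simp: copositive_cone_def)
    have "t \<bullet> (D *v v) = 0"
    proof (rule inner_eq_0_cart)
      fix i
      assume "t $ i \<noteq> 0"
      then have "v $ i > 0"
        using t0[of i] sub by (force simp: pos_support_def)
      then show "(D *v v) $ i = 0"
        by (intro copositive_zero_eq_0 cop v0 zerosD(3)[OF v D])
    qed
    then show ?thesis
      unfolding w_def quadratic_form_scaleR quadratic_form_add[OF sym]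
      by (simp add: zerosD(3)[OF v D] zerosD(3)[OF t D])
  qed
  moreover have "(\<Sum>j\<in>UNIV. w $ j) = 1"
    using s1 sum by (simp add: w flip: sum_divide_distrib)
  ultimately have "w \<in> zeros Q"
    using le s1 by (simp add: zeros_def unit_simplex_def w)
  moreover have "pos_support w \<subset> pos_support v"
  proof
    show "pos_support w \<subseteq> pos_support v"
    proof
      fix j
      assume "j \<in> pos_support w"
      then have "s * t $ j < v $ j"
        using s1 by (simp add: pos_support_def w zero_less_divide_iff)
      moreover have "0 \<le> s * t $ j"
        using s0 t0 by simp
      ultimately show "j \<in> pos_support v"
        by (simp add: pos_support_def)
    qed
    show "pos_support w \<noteq> pos_support v"
    proof -
      have "k \<notin> pos_support w"
        using vk by (simp add: pos_support_def w)
      with \<open>k \<in> pos_support v\<close> show ?thesis by blast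
    qed
  qed
  moreover have "v = s *\<^sub>R t + (1 - s) *\<^sub>R w"
    using s1 by (simp add: w_def)
  ultimately show ?thesis
    using that s0 s1 by blast
qed

text \<open>Carries the conditions on \<open>D\<close> from minimal zeros to all zeros: a nonminimal
  zero is a convex combination of two zeros of strictly smaller support.\<close>

lemma zeros_M_set:
  fixes Q :: "(real ^ 'n ^ 'n) set"
  assumes Q: "Q \<subseteq> copositive_cone"
    and D: "\<And>\<tau> k. \<tau> \<in> minimal_zeros Q \<Longrightarrow> k \<in> M_set Q \<tau> \<Longrightarrow> (D *v \<tau>) $ k = 0"
    and "v \<in> zeros Q" and "i \<in> M_set Q v"
  shows "(D *v v) $ i = 0"
  using \<open>v \<in> zeros Q\<close> \<open>i \<in> M_set Q v\<close>
proof (induction "card (pos_support v)" arbitrary: v rule: less_induct)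
  case less
  show ?case
  proof (cases "v \<in> minimal_zeros Q")
    case True
    with less.prems(2) D show ?thesis by blast
  next
    case False
    then obtain t where "t \<in> zeros Q" "t \<noteq> v" "pos_support t \<subseteq> pos_support v"
      using less.prems(1) by (auto simp: minimal_zeros_def)
    then obtain w where w: "w \<in> zeros Q" "pos_support w \<subset> pos_support v"
      using zeros_split[OF Q less.prems(1)] by metis
    \<comment> \<open>\<open>t\<close> may have the same support as \<open>v\<close>, so split a second time, now along \<open>w\<close>.\<close>
    then obtain s w' where s: "0 < s" "s < 1"
        and w': "w' \<in> zeros Q" "pos_support w' \<subset> pos_support v"
        and v: "v = s *\<^sub>R w + (1 - s) *\<^sub>R w'"
      using zeros_split[OF Q less.prems(1), of w] by blast
    have eq: "(E *v v) $ i = s * (E *v w) $ i + (1 - s) * (E *v w') $ i" for E :: "real ^ 'n ^ 'n"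
      by (simp add: v matrix_vector_right_distrib matrix_vector_mult_scaleR)
    \<comment> \<open>A combination of two nonnegative numbers with positive weights is 0 only if
      both are, so membership of \<open>i\<close> in \<open>M_set Q v\<close> passes to
      \<open>w\<close> and \<open>w'\<close>.\<close>
    have "(E *v w) $ i = 0 \<and> (E *v w') $ i = 0" if E: "E \<in> Q" for E
    proof -
      have "0 \<le> (E *v w) $ i" "0 \<le> (E *v w') $ i"
        using E Q zerosD[OF w(1)] zerosD[OF w'(1)] by (auto intro!: copositive_zero_nonneg)
      moreover have "s * (E *v w) $ i + (1 - s) * (E *v w') $ i = 0"
        using less.prems(2) E eq by (simp add: M_set_def inner_axis')
      ultimately show ?thesis
        using s by (simp add: add_nonneg_eq_0_iff)
    qed
    then have "i \<in> M_set Q w" "i \<in> M_set Q w'"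
      by (auto simp: M_set_def inner_axis')
    then have "(D *v w) $ i = 0" "(D *v w') $ i = 0"
      using less.hyps w w' by (auto simp: psubset_card_mono)
    then show ?thesis
      by (simp add: eq)
  qed
qed

section \<open>Subtracting a small multiple of \<open>D\<close> from \<open>A\<close>\<close>

lemma compact_unit_simplex: "compact (unit_simplex :: (real ^ 'n) set)"
proof -
  have "norm x \<le> 1" if "x \<in> unit_simplex" for x :: "real ^ 'n"
    using norm_le_l1_cart[of x] that by (simp add: unit_simplex_def)
  then have "bounded (unit_simplex :: (real ^ 'n) set)"
    by (auto simp: bounded_iff)
  moreover have "closed (unit_simplex :: (real ^ 'n) set)"
    unfolding unit_simplex_def
    by (intro closed_Collect_conj closed_Collect_all closed_Collect_le closed_Collect_eq
        continuous_intros)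
  ultimately show ?thesis
    by (simp add: compact_eq_bounded_closed)
qed

text \<open>If no \<epsilon> works, simplex points where the perturbed form is negative accumulate,
  as the perturbation tends to 0, at a zero \<open>v\<close> of \<open>A\<close>; this is refuted
  near \<open>v\<close>. The set \<open>I\<close> serves the induction, and the final use is
  \<open>I = UNIV\<close>.\<close>

lemma copositive_diff_on_support:
  fixes A D :: "real ^ 'n ^ 'n"
  assumes A: "A \<in> copositive_cone" and D: "D \<in> copositive_cone"
    and H: "\<And>v i. v \<in> unit_simplex \<Longrightarrow> v \<bullet> (A *v v) = 0 \<Longrightarrow> (A *v v) $ i = 0 \<Longrightarrow> (D *v v) $ i = 0"
  shows "\<exists>\<epsilon>>0. \<forall>x. (\<forall>k. 0 \<le> x $ k) \<longrightarrow> pos_support x \<subseteq> I \<longrightarrow>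
    \<epsilon> * (x \<bullet> (D *v x)) \<le> x \<bullet> (A *v x)"
  using finite[of I]
proof (induction I rule: finite_psubset_induct)
  case (psubset I)
  define B where "B e = A - e *\<^sub>R D" for e
  have B: "B e *v x = A *v x - e *\<^sub>R (D *v x)" for e x
    by (simp add: B_def matrix_vector_mult_diff_rdistrib scaleR_matrix_vector_assoc)
  have symB: "transpose (B e) = B e" for e
    using A D by (simp add: B_def copositive_cone_def transpose_def vec_eq_iff)
  have Dnn: "0 \<le> x \<bullet> (D *v x)" if "\<forall>k. 0 \<le> x $ k" for x
    using D that by (simp add: copositive_cone_def)
  \<comment> \<open>The coordinate to be eliminated is not known in advance, so every
    \<open>I - {k}\<close> contributes its own constant \<open>f k\<close>.\<close>
  have "\<forall>k\<in>I. \<exists>\<epsilon>>0. \<forall>x. (\<forall>j. 0 \<le> x $ j) \<longrightarrow> pos_support x \<subseteq> I - {k} \<longrightarrow>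
      \<epsilon> * (x \<bullet> (D *v x)) \<le> x \<bullet> (A *v x)"
    using psubset.IH by blast
  then obtain f where f0: "\<And>k. k \<in> I \<Longrightarrow> f k > 0"
      and f: "\<And>k x. k \<in> I \<Longrightarrow> \<forall>j. 0 \<le> x $ j \<Longrightarrow> pos_support x \<subseteq> I - {k} \<Longrightarrow>
        f k * (x \<bullet> (D *v x)) \<le> x \<bullet> (A *v x)"
    by metis
  show ?case
  proof (rule ccontr)
    assume "\<not> ?case"
    then have neg: "\<exists>x. (\<forall>k. 0 \<le> x $ k) \<and> pos_support x \<subseteq> I \<and> x \<bullet> (B e *v x) < 0"
      if "e > 0" for e
      using that by (force simp: B inner_diff_right)
    have "\<exists>x. x \<in> unit_simplex \<and> pos_support x \<subseteq> I \<and> x \<bullet> (B e *v x) < 0" if "e > 0" for e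
    proof -
      obtain x where x: "\<forall>k. 0 \<le> x $ k" "pos_support x \<subseteq> I" "x \<bullet> (B e *v x) < 0"
        using neg[OF \<open>e > 0\<close>] by blast
      define c where "c = (\<Sum>k\<in>UNIV. x $ k)"
      have "x \<noteq> 0"
        using x(3) by auto
      then have "c \<noteq> 0"
        using x(1) by (simp add: c_def sum_nonneg_eq_0_iff vec_eq_iff)
      moreover have "c \<ge> 0"
        using x(1) by (simp add: c_def sum_nonneg)
      ultimately have "c > 0" by simp
      then have "(1 / c) *\<^sub>R x \<in> unit_simplex"
        using x(1) by (simp add: unit_simplex_def c_def flip: sum_divide_distrib)
      moreover have "pos_support ((1 / c) *\<^sub>R x) \<subseteq> I"
        using x(2) \<open>c > 0\<close> by (auto simp: pos_support_def zero_less_divide_iff)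
      moreover have "((1 / c) *\<^sub>R x) \<bullet> (B e *v ((1 / c) *\<^sub>R x)) < 0"
        unfolding quadratic_form_scaleR using x(3) \<open>c > 0\<close> by (simp add: mult_pos_neg)
      ultimately show ?thesis by blast
    qed
    then have "\<forall>n. \<exists>x. x \<in> unit_simplex \<and> pos_support x \<subseteq> I \<and>
        x \<bullet> (B (inverse (real (Suc n))) *v x) < 0"
      by simp
    then obtain X where X: "\<And>n. X n \<in> unit_simplex" "\<And>n. pos_support (X n) \<subseteq> I"
        "\<And>n. X n \<bullet> (B (inverse (real (Suc n))) *v X n) < 0"
      by metis
    obtain v r where v: "v \<in> unit_simplex" and r: "strict_mono r" and "(X \<circ> r) \<longlonglongrightarrow> v"
      using compact_unit_simplex X(1) unfolding compact_def by metis
    define x where "x = X \<circ> r"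
    define e where "e = (\<lambda>n. inverse (real (Suc (r n))))"
    have x_lim: "x \<longlonglongrightarrow> v"
      using \<open>(X \<circ> r) \<longlonglongrightarrow> v\<close> by (simp add: x_def)
    have e_lim: "e \<longlonglongrightarrow> 0"
      using LIMSEQ_subseq_LIMSEQ[OF LIMSEQ_inverse_real_of_nat r] by (simp add: e_def comp_def)
    have x0: "0 \<le> x n $ k" and xI: "pos_support (x n) \<subseteq> I" and xneg: "x n \<bullet> (B (e n) *v x n) < 0"
      for n k
      using X by (auto simp: x_def e_def unit_simplex_def)
    have e0: "e n > 0" for n
      by (simp add: e_def)
    have v0: "0 \<le> v $ k" for k
      using v by (simp add: unit_simplex_def)
    have B_lim: "(\<lambda>n. B (e n) *v y n) \<longlonglongrightarrow> A *v v" if "y \<longlonglongrightarrow> v" for y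
    proof -
      have "(\<lambda>n. M *v y n) \<longlonglongrightarrow> M *v v" for M :: "real ^ 'n ^ 'n"
        by (rule bounded_linear.tendsto[OF matrix_vector_mul_bounded_linear that])
      then have "(\<lambda>n. A *v y n - e n *\<^sub>R (D *v y n)) \<longlonglongrightarrow> A *v v - 0 *\<^sub>R (D *v v)"
        by (intro tendsto_intros e_lim)
      then show ?thesis
        by (simp add: B)
    qed
    have "v \<bullet> (A *v v) \<le> 0"
      by (rule tendsto_upperbound[OF tendsto_inner[OF x_lim B_lim[OF x_lim]]])
        (use xneg in \<open>auto intro!: always_eventually less_imp_le\<close>)
    moreover have "0 \<le> v \<bullet> (A *v v)"
      using A v0 by (simp add: copositive_cone_def)
    ultimately have zero: "v \<bullet> (A *v v) = 0" by simp
    note Av = copositive_zero_nonneg[OF A v0 zero] copositive_zero_eq_0[OF A v0 zero]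
    define K where "K = {i. (A *v v) $ i = 0}"
    \<comment> \<open>The coordinate eliminated later is positive in \<open>v\<close>; lying in
      \<open>I\<close>, it has a constant \<open>f k\<close>.\<close>
    have vI: "i \<in> I" if "v $ i > 0" for i
    proof (rule ccontr)
      assume "i \<notin> I"
      then have "x n $ i = 0" for n
        using xI[of n] x0[of n i] by (force simp: pos_support_def)
      then have "(\<lambda>n. 0) \<longlonglongrightarrow> v $ i"
        using tendsto_vec_nth[OF x_lim, of i] by simp
      with that show False
        by (simp add: LIMSEQ_const_iff)
    qed
    \<comment> \<open>Only the coordinates in \<open>K\<close> are kept. Outside \<open>K\<close>
      the limit \<open>v\<close> is 0 by complementary slackness, so \<open>u\<close> still tends to
      \<open>v\<close>.\<close>
    define u where "u n = (\<chi> i. if i \<in> K then x n $ i else 0)" for n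
    have u_lim: "u \<longlonglongrightarrow> v"
    proof (rule vec_tendstoI)
      fix i
      show "(\<lambda>n. u n $ i) \<longlonglongrightarrow> v $ i"
      proof (cases "i \<in> K")
        case True
        then show ?thesis
          using tendsto_vec_nth[OF x_lim, of i] by (simp add: u_def)
      next
        case False
        then have "v $ i = 0"
          using Av(2)[of i] v0[of i] by (force simp: K_def)
        with False show ?thesis
          by (simp add: u_def)
      qed
    qed
    \<comment> \<open>By symmetry the forms at \<open>x n\<close> and \<open>u n\<close> differ by
      the inner product of \<open>x n - u n\<close> with this sum of vectors. The difference
      \<open>x n - u n\<close> is nonnegative and supported outside \<open>K\<close>, where the sum
      tends to \<open>2 * (A *v v) $ i > 0\<close>.\<close>
    have "\<forall>\<^sub>F n in sequentially. \<forall>i\<in>-K. 0 < (B (e n) *v x n) $ i + (B (e n) *v u n) $ i"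
    proof (rule eventually_ball_finite)
      show "\<forall>i\<in>-K. \<forall>\<^sub>F n in sequentially. 0 < (B (e n) *v x n) $ i + (B (e n) *v u n) $ i"
      proof
        fix i
        assume "i \<in> - K"
        then have "0 < (A *v v) $ i + (A *v v) $ i"
          using Av(1)[of i] by (simp add: K_def)
        moreover have "(\<lambda>n. (B (e n) *v x n) $ i + (B (e n) *v u n) $ i)
            \<longlonglongrightarrow> (A *v v) $ i + (A *v v) $ i"
          by (intro tendsto_add tendsto_vec_nth B_lim x_lim u_lim)
        ultimately show "\<forall>\<^sub>F n in sequentially. 0 < (B (e n) *v x n) $ i + (B (e n) *v u n) $ i"
          by (rule order_tendstoD(1)[rotated])
      qed
    qed simp
    moreover have "\<forall>\<^sub>F n in sequentially. \<forall>k\<in>I. e n < f k"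
      by (rule eventually_ball_finite) (use order_tendstoD(2)[OF e_lim] f0 in auto)
    ultimately have "\<forall>\<^sub>F n in sequentially. False"
    proof eventually_elim
      case (elim n)
      define y where "y = x n - u n"
      have xy: "x n = u n + y"
        by (simp add: y_def)
      have "0 \<le> y \<bullet> (B (e n) *v x n + B (e n) *v u n)"
        unfolding inner_vec_def
      proof (rule sum_nonneg)
        fix i
        show "0 \<le> y $ i \<bullet> (B (e n) *v x n + B (e n) *v u n) $ i"
          using elim(1) x0[of n i] by (cases "i \<in> K") (auto simp: y_def u_def less_imp_le)
      qed
      then have ynn: "0 \<le> 2 * (y \<bullet> (B (e n) *v u n)) + y \<bullet> (B (e n) *v y)"
        unfolding xy matrix_vector_right_distrib inner_add_right by linarith
      have "v \<noteq> 0"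
        using v by (auto simp: unit_simplex_def)
      moreover have u0: "0 \<le> u n $ k" for k
        by (simp add: u_def x0)
      ultimately obtain k s where k: "v $ k > 0" and "0 \<le> s" and uk: "u n $ k = s * v $ k"
          and le: "\<And>j. s * v $ j \<le> u n $ j"
        using subtract_multiple_nonneg[of "u n" v] v0 by metis
      \<comment> \<open>\<open>w\<close> has support in \<open>K\<close> and in
        \<open>I - {k}\<close>. Since \<open>B (e n) *v v\<close> vanishes on \<open>K\<close> by
        \<open>H\<close>, and \<open>K\<close> contains the supports of \<open>v\<close> and
        \<open>w\<close>, the form takes the same value at \<open>u n\<close> and \<open>w\<close>;
        there the induction hypothesis applies.\<close>
      define w where "w = u n - s *\<^sub>R v"
      have uw: "u n = s *\<^sub>R v + w"
        by (simp add: w_def)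
      have w0: "\<forall>j. 0 \<le> w $ j"
        using le by (simp add: w_def)
      have wu: "u n $ j > 0" if "w $ j > 0" for j
      proof -
        have "0 \<le> s * v $ j"
          using \<open>0 \<le> s\<close> v0 by simp
        with that show ?thesis
          by (simp add: w_def)
      qed
      have wK: "j \<in> K" if "w $ j \<noteq> 0" for j
        using wu[of j] w0 that by (force simp: u_def order.order_iff_strict split: if_splits)
      have "pos_support w \<subseteq> I - {k}"
        using wu xI[of n] uk by (force simp: pos_support_def w_def u_def split: if_splits)
      then have "f k * (w \<bullet> (D *v w)) \<le> w \<bullet> (A *v w)"
        using f[OF vI[OF k] w0] by blast
      moreover have "e n * (w \<bullet> (D *v w)) \<le> f k * (w \<bullet> (D *v w))"
        using elim(2) vI[OF k] Dnn[OF w0] by (intro mult_right_mono) auto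
      ultimately have wnn: "0 \<le> w \<bullet> (B (e n) *v w)"
        by (simp add: B inner_diff_right)
      have BK: "(B (e n) *v v) $ j = 0" if "j \<in> K" for j
        using H[OF v zero, of j] that by (simp add: B K_def)
      have "w \<bullet> (B (e n) *v v) = 0"
        by (rule inner_eq_0_cart) (use wK BK in blast)
      moreover have "v \<bullet> (B (e n) *v v) = 0"
      proof (rule inner_eq_0_cart)
        fix j
        assume "v $ j \<noteq> 0"
        then have "v $ j > 0"
          using v0[of j] by simp
        then show "(B (e n) *v v) $ j = 0"
          using Av(2) by (intro BK) (simp add: K_def)
      qed
      ultimately have "u n \<bullet> (B (e n) *v u n) = w \<bullet> (B (e n) *v w)"
        unfolding uw quadratic_form_add[OF symB] quadratic_form_scaleR
        by (simp add: matrix_vector_mult_scaleR)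
      then have "0 \<le> x n \<bullet> (B (e n) *v x n)"
        unfolding xy quadratic_form_add[OF symB] using ynn wnn by simp
      with xneg[of n] show False by simp
    qed
    then show False by simp
  qed
qed

section \<open>The face cut out by zeros, and its minimality\<close>

text \<open>The support of a zero \<tau> lies in \<open>M_set Q \<tau>\<close>. So if
  \<open>A + B\<close> is in the set, the forms of \<open>A\<close> and \<open>B\<close> at \<tau>
  are nonnegative with sum 0, and \<tau> is a zero of both. Then \<open>A *v \<tau>\<close> and
  \<open>B *v \<tau>\<close> are nonnegative, and their entries on \<open>M_set Q \<tau>\<close>
  cancel only by vanishing.\<close>

lemma cone_face_zeros:
  fixes Q :: "(real ^ 'n ^ 'n) set"
  assumes Q: "Q \<subseteq> copositive_cone" and Z: "Z \<subseteq> zeros Q"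
  shows "cone_face {D \<in> copositive_cone. \<forall>\<tau>\<in>Z. \<forall>k\<in>M_set Q \<tau>. (D *v \<tau>) $ k = 0}
    copositive_cone" (is "cone_face ?G _")
proof -
  have cone: "convex_cone (copositive_cone :: (real ^ 'n ^ 'n) set)"
    by (rule convex_cone_copositive_cone)
  then have "convex_cone ?G"
    unfolding convex_cone_iff
    by (auto simp: matrix_vector_mult_add_rdistrib simp flip: scaleR_matrix_vector_assoc)
  moreover have "A \<in> ?G \<and> B \<in> ?G"
    if A: "A \<in> copositive_cone" and B: "B \<in> copositive_cone" and AB: "A + B \<in> ?G" for A B
  proof -
    have "(A *v \<tau>) $ k = 0 \<and> (B *v \<tau>) $ k = 0" if "\<tau> \<in> Z" and k: "k \<in> M_set Q \<tau>" for \<tau> k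
    proof -
      have \<tau>: "\<tau> \<in> zeros Q"
        using \<open>\<tau> \<in> Z\<close> Z by blast
      note \<tau>0 = zerosD(1)[OF \<tau>]
      have sum: "(A *v \<tau>) $ j + (B *v \<tau>) $ j = 0" if "j \<in> M_set Q \<tau>" for j
        using AB \<open>\<tau> \<in> Z\<close> that by (simp add: matrix_vector_mult_add_rdistrib)
      have "\<tau> \<bullet> (A *v \<tau> + B *v \<tau>) = 0"
      proof (rule inner_eq_0_cart)
        fix j
        assume "\<tau> $ j \<noteq> 0"
        then have "\<tau> $ j > 0"
          using \<tau>0[of j] by simp
        then have "j \<in> M_set Q \<tau>"
          using Q \<tau>0 zerosD(3)[OF \<tau>] copositive_zero_eq_0[of _ \<tau> j]
          by (auto simp: M_set_def inner_axis')
        with sum show "(A *v \<tau> + B *v \<tau>) $ j = 0" by simp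
      qed
      moreover have "0 \<le> \<tau> \<bullet> (A *v \<tau>)" "0 \<le> \<tau> \<bullet> (B *v \<tau>)"
        using A B \<tau>0 by (simp_all add: copositive_cone_def)
      ultimately have "\<tau> \<bullet> (A *v \<tau>) = 0" "\<tau> \<bullet> (B *v \<tau>) = 0"
        by (simp_all add: inner_add_right)
      then have "0 \<le> (A *v \<tau>) $ k" "0 \<le> (B *v \<tau>) $ k"
        by (simp_all add: copositive_zero_nonneg A B \<tau>0)
      with sum[OF k] show ?thesis by simp
    qed
    with A B show ?thesis by blast
  qed
  ultimately show ?thesis
    unfolding cone_face_def by blast
qed

theorem theorem4:
  fixes Q :: "(real ^ 'n ^ 'n) set"
  assumes "CARD('n) > 1"
    and "Q \<subseteq> copositive_cone"
    and "Q \<noteq> {}"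
    and "closed Q"
    and "convex Q"
  shows "min_face Q copositive_cone =
    {D \<in> copositive_cone. \<forall>\<tau> \<in> minimal_zeros Q. \<forall>k \<in> M_set Q \<tau>. axis k 1 \<bullet> (D *v \<tau>) = 0}"
proof -
  note Q = \<open>Q \<subseteq> copositive_cone\<close>
  have cone: "convex_cone (copositive_cone :: (real ^ 'n ^ 'n) set)"
    by (rule convex_cone_copositive_cone)
  define G where
    "G = {D \<in> copositive_cone. \<forall>\<tau> \<in> minimal_zeros Q. \<forall>k \<in> M_set Q \<tau>. (D *v \<tau>) $ k = 0}"
  have "minimal_zeros Q \<subseteq> zeros Q"
    by (auto simp: minimal_zeros_def)
  then have "cone_face G copositive_cone"
    unfolding G_def by (rule cone_face_zeros[OF Q])
  moreover have "Q \<subseteq> G"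
    using Q by (auto simp: G_def M_set_def inner_axis')
  ultimately have "min_face Q copositive_cone \<subseteq> G"
    by (rule min_face_least[OF cone Q])
  moreover have "G \<subseteq> min_face Q copositive_cone" (is "_ \<subseteq> ?F")
  proof
    fix D
    assume "D \<in> G"
    then have D: "D \<in> copositive_cone"
        and DM: "\<And>\<tau> k. \<tau> \<in> minimal_zeros Q \<Longrightarrow> k \<in> M_set Q \<tau> \<Longrightarrow> (D *v \<tau>) $ k = 0"
      by (auto simp: G_def)
    obtain A where ri: "A \<in> rel_interior Q"
      using \<open>convex Q\<close> \<open>Q \<noteq> {}\<close> rel_interior_eq_empty by blast
    then have "A \<in> Q"
      using rel_interior_subset by blast
    with Q have A: "A \<in> copositive_cone" by blast
    have generic: "v \<bullet> (E *v v) = 0 \<and> ((A *v v) $ i = 0 \<longrightarrow> (E *v v) $ i = 0)"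
      if v: "v \<in> unit_simplex" and zero: "v \<bullet> (A *v v) = 0" and "E \<in> Q" for v E i
    proof -
      \<comment> \<open>The segment from \<open>E\<close> through the relative interior point
        \<open>A\<close> continues inside \<open>Q\<close> beyond \<open>A\<close>. Hence
        \<open>c *\<^sub>R A\<close> is the sum of a member of \<open>Q\<close> and a positive
        multiple of \<open>E\<close>, and zeros of the sum are zeros of both terms.\<close>
      obtain c where c: "c > 1" and C: "(1 - c) *\<^sub>R E + c *\<^sub>R A \<in> Q" (is "?C \<in> Q")
        using ri convex_rel_interior_iff[OF \<open>convex Q\<close> \<open>Q \<noteq> {}\<close>] \<open>E \<in> Q\<close> by blast
      have v0: "0 \<le> v $ k" for k
        using v by (simp add: unit_simplex_def)
      have Cv: "?C *v v + (c - 1) *\<^sub>R (E *v v) = c *\<^sub>R (A *v v)"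
        by (simp add: matrix_vector_mult_add_rdistrib algebra_simps
            flip: scaleR_matrix_vector_assoc)
      have cop: "?C \<in> copositive_cone" "E \<in> copositive_cone"
        using C \<open>E \<in> Q\<close> Q by auto
      have "v \<bullet> (?C *v v) + (c - 1) * (v \<bullet> (E *v v)) = 0"
        using arg_cong[OF Cv, of "inner v"] zero by (simp add: inner_add_right)
      moreover have "0 \<le> v \<bullet> (?C *v v)" "0 \<le> v \<bullet> (E *v v)"
        using cop v0 by (auto simp: copositive_cone_def)
      ultimately have zeros: "v \<bullet> (?C *v v) = 0" "v \<bullet> (E *v v) = 0"
        using c by (simp_all add: add_nonneg_eq_0_iff)
      moreover have "(E *v v) $ i = 0" if "(A *v v) $ i = 0"
      proof -
        have "(?C *v v) $ i + (c - 1) * (E *v v) $ i = 0"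
          using arg_cong[OF Cv, of "\<lambda>x. x $ i"] that by simp
        moreover have "0 \<le> (?C *v v) $ i" "0 \<le> (E *v v) $ i"
          using copositive_zero_nonneg[OF cop(1) v0 zeros(1)]
            copositive_zero_nonneg[OF cop(2) v0 zeros(2)] by blast+
        ultimately show ?thesis
          using c by (simp add: add_nonneg_eq_0_iff)
      qed
      ultimately show ?thesis by blast
    qed
    have "(D *v v) $ i = 0"
      if v: "v \<in> unit_simplex" "v \<bullet> (A *v v) = 0" "(A *v v) $ i = 0" for v i
    proof (rule zeros_M_set[OF Q DM])
      show "v \<in> zeros Q"
        using generic v by (simp add: zeros_def)
      show "i \<in> M_set Q v"
        using generic v by (simp add: M_set_def inner_axis')
    qed
    then obtain \<epsilon> where \<epsilon>: "\<epsilon> > 0"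
        and le: "\<And>x. \<forall>k. 0 \<le> x $ k \<Longrightarrow> \<epsilon> * (x \<bullet> (D *v x)) \<le> x \<bullet> (A *v x)"
      using copositive_diff_on_support[OF A D, of UNIV] by auto
    have F: "cone_face ?F copositive_cone" "Q \<subseteq> ?F"
      by (rule cone_face_min_face subset_min_face; fact cone Q)+
    have "A - \<epsilon> *\<^sub>R D \<in> copositive_cone"
      using A D le
      by (simp add: copositive_cone_def transpose_def vec_eq_iff matrix_vector_mult_diff_rdistrib
          inner_diff_right flip: scaleR_matrix_vector_assoc)
    moreover have "\<epsilon> *\<^sub>R D \<in> copositive_cone"
      using cone D \<epsilon> unfolding convex_cone_iff by (simp add: less_imp_le)
    moreover have "(A - \<epsilon> *\<^sub>R D) + \<epsilon> *\<^sub>R D \<in> ?F"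
      using \<open>A \<in> Q\<close> F(2) by auto
    ultimately have "\<epsilon> *\<^sub>R D \<in> ?F"
      using F(1) unfolding cone_face_def by blast
    \<comment> \<open>The decomposition of \<open>A\<close> yields only the multiple
      \<open>\<epsilon> *\<^sub>R D\<close>; rescaling inside the conic face recovers
      \<open>D\<close>.\<close>
    then have "(1 / \<epsilon>) *\<^sub>R (\<epsilon> *\<^sub>R D) \<in> ?F"
      using F(1) \<epsilon> unfolding cone_face_def convex_cone_iff
      by (meson divide_nonneg_pos zero_le_one)
    with \<epsilon> show "D \<in> ?F" by simp
  qed
  ultimately show ?thesis
    by (simp add: G_def inner_axis')
qed

end
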